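(* Let $\mathcal K$ be any field of characteristic different from $2$, let $\mathcal A$ be an associative commutative algebra over $\mathcal K$, let $\partial\in\mathrm{Der}(\mathcal A)$, and let $\mathcal L=\mathcal A\oplus\mathcal A$. Let $\mu$ be the componentwise (associative commutative) multiplication on $\mathcal L$, and let $\varphi$ be the Lie bracket on $\mathcal L$ given by $$\varphi\big((a,c),(b,d)\big)=\big(a\,\partial(b)-\partial(a)\,b,\; a\,\partial(d)-b\,\partial(c)\big),\qquad a,b,c,d\in\mathcal A .$$ If there exists $H=(h,h)\in\mathcal L$ (with $h\in\mathcal A$) such that the ideal of $(\mathcal L,\mu)$ generated by $\big(2\partial(h),\partial(h)\big)$ has finite codimension in $\mathcal L$, then $\mathcal L^{\circ}_{\mu}=\mathcal L^{\circ}_{\varphi}$. In particular, for the centerless twisted Heisenberg-Virasoro algebra $\overline{\mathcal{HV}}$ one has $\overline{\mathcal{HV}}{}^{\circ}_{\mu}=\overline{\mathcal{HV}}{}^{\circ}_{\varphi}$.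
   Context: For a vector space $\mathcal L$ with a bilinear multiplication $\psi:\mathcal L\otimes\mathcal L\to\mathcal L$ (either an associative commutative product or a Lie bracket), let $\psi^*:\mathcal L^*\to(\mathcal L\otimes\mathcal L)^*$ be the dual map, and regard $\mathcal L^*\otimes\mathcal L^*\subset(\mathcal L\otimes\mathcal L)^*$. A subspace $U\subset\mathcal L^*$ is good (with respect to $\psi$) if $\psi^*(U)\subset U\otimes U$. The maximal good subspace $\mathcal L^\circ_\psi$ is the sum of all good subspaces of $\mathcal L^*$ with respect to $\psi$. $\overline{\mathcal{HV}}$ is the case where $\mathcal K$ is an algebraically closed field of characteristic zero, $\mathcal A=\mathcal K[x^{\pm1}]$, $\partial=\frac{d}{dx}$, and $\overline{\mathcal{HV}}=\mathcal A\oplus\mathcal A$, with $\mu$ the componentwise multiplication and $\varphi$ the Lie bracket given by $\varphi\big((a,c),(b,d)\big)=\big(a\,\partial(b)-\partial(a)\,b,\; a\,\partial(d)-b\,\partial(c)\big)$ for $a,b,c,d\in\mathcal A$. With $L_m=(x^{m+1},0)$ and $I_n=(0,x^n)$ this bracket is $[L_m,L_n]=(n-m)L_{m+n}$, $[I_m,I_n]=0$, $[L_m,I_n]=nI_{m+n}$ for $m,n\in\mathbb Z$. *)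

theory Defs
  imports
    "HOL-Computational_Algebra.Computational_Algebra"
    "HOL-Library.Poly_Mapping"
    "HOL-Library.Function_Algebras"
    "HOL-Analysis.Product_Vector"
begin

section \<open>Good subspaces of the dual\<close>

definition fun_scale :: "'k::field \<Rightarrow> ('x \<Rightarrow> 'k) \<Rightarrow> 'x \<Rightarrow> 'k" where
  "fun_scale c f = (\<lambda>x. c * f x)"

lemma vector_space_fun_scale: "vector_space fun_scale"
  by standard (auto simp: fun_scale_def fun_eq_iff algebra_simps)

definition dual_space :: "('k::field \<Rightarrow> 'l::ab_group_add \<Rightarrow> 'l) \<Rightarrow> ('l \<Rightarrow> 'k) set" where
  "dual_space s = {f. Vector_Spaces.linear s (*) f}"

text \<open>
  By the universal property of the tensor product, an element of the dual of L \<open>\<otimes>\<close> L is the same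
  thing as a bilinear form on L; it is represented here by the function on pairs \<open>(u, v)\<close> giving its
  value on u \<open>\<otimes>\<close> v.  In this representation the inclusion of the tensor product of the duals into the
  dual of the tensor product sends f \<open>\<otimes>\<close> g to \<open>\<lambda>(u, v). f u * g v\<close>.
\<close>

definition dual_map :: "('l \<Rightarrow> 'l \<Rightarrow> 'l) \<Rightarrow> ('l \<Rightarrow> 'k) \<Rightarrow> 'l \<times> 'l \<Rightarrow> 'k" where
  "dual_map \<psi> f = (\<lambda>(u, v). f (\<psi> u v))"

definition tensor_square :: "('l \<Rightarrow> 'k::field) set \<Rightarrow> ('l \<times> 'l \<Rightarrow> 'k) set" where
  "tensor_square U = module.span fun_scale {\<lambda>(u, v). f u * g v | f g. f \<in> U \<and> g \<in> U}"

definition good_subspace ::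
  "('k::field \<Rightarrow> 'l::ab_group_add \<Rightarrow> 'l) \<Rightarrow> ('l \<Rightarrow> 'l \<Rightarrow> 'l) \<Rightarrow> ('l \<Rightarrow> 'k) set \<Rightarrow> bool" where
  "good_subspace s \<psi> U \<longleftrightarrow>
     U \<subseteq> dual_space s \<and> module.subspace fun_scale U \<and> dual_map \<psi> ` U \<subseteq> tensor_square U"

text \<open>The sum of a family of subspaces is the span of its union.\<close>

definition max_good_subspace ::
  "('k::field \<Rightarrow> 'l::ab_group_add \<Rightarrow> 'l) \<Rightarrow> ('l \<Rightarrow> 'l \<Rightarrow> 'l) \<Rightarrow> ('l \<Rightarrow> 'k) set" where
  "max_good_subspace s \<psi> = module.span fun_scale (\<Union>{U. good_subspace s \<psi> U})"


section \<open>Algebras, derivations, ideals\<close>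

text \<open>Associativity and commutativity come from the class \<open>comm_ring\<close>; a unit is not required.\<close>

locale comm_algebra = vector_space s
  for s :: "'k::field \<Rightarrow> 'a::comm_ring \<Rightarrow> 'a" +
  assumes scale_mult_left: "s c (x * y) = s c x * y"

definition derivation :: "('k::field \<Rightarrow> 'a::comm_ring \<Rightarrow> 'a) \<Rightarrow> ('a \<Rightarrow> 'a) \<Rightarrow> bool" where
  "derivation s D \<longleftrightarrow>
     Vector_Spaces.linear s s D \<and> (\<forall>x y. D (x * y) = D x * y + x * D y)"

definition algebra_ideal ::
  "('k::field \<Rightarrow> 'l::ab_group_add \<Rightarrow> 'l) \<Rightarrow> ('l \<Rightarrow> 'l \<Rightarrow> 'l) \<Rightarrow> 'l set \<Rightarrow> bool" where
  "algebra_ideal s \<psi> I \<longleftrightarrow>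
     module.subspace s I \<and> (\<forall>x\<in>I. \<forall>y. \<psi> x y \<in> I \<and> \<psi> y x \<in> I)"

definition ideal_generated_by ::
  "('k::field \<Rightarrow> 'l::ab_group_add \<Rightarrow> 'l) \<Rightarrow> ('l \<Rightarrow> 'l \<Rightarrow> 'l) \<Rightarrow> 'l \<Rightarrow> 'l set" where
  "ideal_generated_by s \<psi> p = \<Inter>{I. algebra_ideal s \<psi> I \<and> p \<in> I}"

text \<open>The quotient by W is finite-dimensional, i.e. spanned by the classes of a finite set B.\<close>

definition finite_codim :: "('k::field \<Rightarrow> 'l::ab_group_add \<Rightarrow> 'l) \<Rightarrow> 'l set \<Rightarrow> bool" where
  "finite_codim s W \<longleftrightarrow>
     (\<exists>B. finite B \<and> (\<forall>v. \<exists>w \<in> module.span s B. v - w \<in> W))"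


section \<open>The algebra A \<open>\<oplus>\<close> A\<close>

abbreviation pair_scale :: "('k::field \<Rightarrow> 'a::ab_group_add \<Rightarrow> 'a) \<Rightarrow> 'k \<Rightarrow> 'a \<times> 'a \<Rightarrow> 'a \<times> 'a" where
  "pair_scale s \<equiv> module_prod.scale s s"

fun pair_mult :: "'a::comm_ring \<times> 'a \<Rightarrow> 'a \<times> 'a \<Rightarrow> 'a \<times> 'a" where
  "pair_mult (a, c) (b, d) = (a * b, c * d)"

fun pair_bracket :: "('a::comm_ring \<Rightarrow> 'a) \<Rightarrow> 'a \<times> 'a \<Rightarrow> 'a \<times> 'a \<Rightarrow> 'a \<times> 'a" where
  "pair_bracket D (a, c) (b, d) = (a * D b - D a * b, a * D d - b * D c)"

lemma pair_scale_simp: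
  assumes "comm_algebra s"
  shows "pair_scale s k (a, c) = (s k a, s k c)"
proof -
  interpret comm_algebra s by fact
  interpret module_prod s s ..
  show ?thesis by (rule scale_prod)
qed

lemma pair_bracket_self: "pair_bracket D u u = 0"
  by (cases u) (simp add: algebra_simps zero_prod_def)

lemma pair_bracket_jacobi:
  assumes "derivation s D"
  shows "pair_bracket D u (pair_bracket D v w) + pair_bracket D v (pair_bracket D w u)
           + pair_bracket D w (pair_bracket D u v) = 0"
proof -
  interpret Vector_Spaces.linear s s D using assms by (simp add: derivation_def)
  have "D (x * y) = D x * y + x * D y" for x y using assms by (simp add: derivation_def)
  then show ?thesis
    by (cases u; cases v; cases w) (simp add: add diff algebra_simps zero_prod_def)
qed


section \<open>Laurent polynomials and the Heisenberg-Virasoro bracket\<close>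

text \<open>
  The algebra of Laurent polynomials is the group algebra of the integers: the finitely supported
  function \<open>p\<close> stands for the sum of \<open>lookup p n\<close> times the n-th power of x, and \<open>single n 1\<close> for the
  n-th power of x itself.  Multiplication of \<open>poly_mapping\<close> is convolution.
\<close>

type_synonym 'k laurent_poly = "int \<Rightarrow>\<^sub>0 'k"

definition laurent_scale :: "'k::field \<Rightarrow> 'k laurent_poly \<Rightarrow> 'k laurent_poly" where
  "laurent_scale c p = Poly_Mapping.map ((*) c) p"

definition laurent_deriv :: "'k::field laurent_poly \<Rightarrow> 'k laurent_poly" where
  "laurent_deriv p = (\<Sum>n\<in>Poly_Mapping.keys p. Poly_Mapping.single (n - 1) (of_int n * Poly_Mapping.lookup p n))"

lemma lookup_laurent_scale: "Poly_Mapping.lookup (laurent_scale c p) n = c * Poly_Mapping.lookup p n"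
  by (simp add: laurent_scale_def map.rep_eq when_def)

lemma lookup_laurent_deriv: "Poly_Mapping.lookup (laurent_deriv p) n = of_int (n + 1) * Poly_Mapping.lookup p (n + 1)"
proof -
  have "Poly_Mapping.lookup (laurent_deriv p) n =
      (\<Sum>m\<in>Poly_Mapping.keys p. if m = n + 1 then of_int m * Poly_Mapping.lookup p m else 0)"
    unfolding laurent_deriv_def lookup_sum
    by (rule sum.cong) (auto simp: lookup_single when_def)
  also have "\<dots> = of_int (n + 1) * Poly_Mapping.lookup p (n + 1)"
    by (subst sum.delta) (auto simp: in_keys_iff)
  finally show ?thesis .
qed

lemma laurent_deriv_single:
  "laurent_deriv (Poly_Mapping.single n c) = Poly_Mapping.single (n - 1) (of_int n * c)"
  by (rule poly_mapping_eqI) (auto simp: lookup_laurent_deriv lookup_single when_def)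

lemma laurent_induct [case_names zero add single]:
  fixes p :: "'k::field laurent_poly"
  assumes "P 0" "\<And>p q. P p \<Longrightarrow> P q \<Longrightarrow> P (p + q)" "\<And>n c. P (Poly_Mapping.single n c)"
  shows "P p"
proof -
  have "P (\<Sum>n\<in>A. Poly_Mapping.single n (Poly_Mapping.lookup p n))" if "finite A" for A
    using that by induction (auto intro: assms)
  moreover have "(\<Sum>n\<in>Poly_Mapping.keys p. Poly_Mapping.single n (Poly_Mapping.lookup p n)) = p"
    by (rule poly_mapping_eqI) (auto simp: lookup_sum lookup_single when_def in_keys_iff)
  ultimately show ?thesis by (metis Poly_Mapping.finite_keys)
qed

lemma laurent_zero: "laurent_scale c 0 = 0" "laurent_deriv 0 = 0"
  by (auto intro!: poly_mapping_eqI simp: lookup_laurent_scale lookup_laurent_deriv)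

lemma laurent_scale_single: "laurent_scale c (Poly_Mapping.single n d) = Poly_Mapping.single n (c * d)"
  by (rule poly_mapping_eqI) (auto simp: lookup_laurent_scale lookup_single when_def)

lemma laurent_scale_add: "laurent_scale c (p + q) = laurent_scale c p + laurent_scale c q"
  by (rule poly_mapping_eqI) (simp add: lookup_laurent_scale lookup_add algebra_simps)

lemma laurent_deriv_add: "laurent_deriv (p + q) = laurent_deriv p + laurent_deriv q"
  by (rule poly_mapping_eqI) (simp add: lookup_laurent_deriv lookup_add algebra_simps)

lemma vector_space_laurent: "vector_space laurent_scale"
  by standard (auto intro!: poly_mapping_eqI simp: lookup_laurent_scale lookup_add algebra_simps)

lemma laurent_scale_eq_mult: "laurent_scale c p = Poly_Mapping.single 0 c * p"
proof (induction p rule: laurent_induct)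
  case zero
  show ?case by (rule poly_mapping_eqI) (simp add: lookup_laurent_scale)
qed (simp_all add: laurent_scale_add laurent_scale_single mult_single algebra_simps)

lemma comm_algebra_laurent: "comm_algebra laurent_scale"
  using vector_space_laurent
  by (simp add: comm_algebra_def comm_algebra_axioms_def laurent_scale_eq_mult mult.assoc)

lemma laurent_deriv_mult:
  "laurent_deriv (p * q) = laurent_deriv p * q + p * laurent_deriv q"
proof (induction p rule: laurent_induct)
  case zero
  show ?case by (simp add: laurent_deriv_def)
next
  case (add p p')
  then show ?case by (simp add: laurent_deriv_add algebra_simps)
next
  case (single n c)
  show ?case
  proof (induction q rule: laurent_induct)
    case zero
    show ?case by (simp add: laurent_deriv_def)
  next
    case (add q q')
    then show ?case by (simp add: laurent_deriv_add algebra_simps)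
  next
    case (single m d)
    show ?case
      by (simp add: mult_single laurent_deriv_single algebra_simps flip: single_add)
  qed
qed

lemma derivation_laurent: "derivation laurent_scale laurent_deriv"
  unfolding derivation_def
proof (intro conjI allI)
  show "Vector_Spaces.linear laurent_scale laurent_scale laurent_deriv"
    using vector_space_laurent
    by (auto simp: Vector_Spaces.linear_iff laurent_deriv_add lookup_laurent_scale
        lookup_laurent_deriv algebra_simps intro!: poly_mapping_eqI)
qed (rule laurent_deriv_mult)

text \<open>
  The bracket specializes to that of the centerless twisted Heisenberg-Virasoro algebra in its usual
  basis \<open>L m\<close>, \<open>I n\<close>.
\<close>

lemma hv_relations:
  fixes L I :: "int \<Rightarrow> 'k::field laurent_poly \<times> 'k laurent_poly"
  defines "L \<equiv> \<lambda>m. (Poly_Mapping.single (m + 1) 1, 0)"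
    and "I \<equiv> \<lambda>n. (0, Poly_Mapping.single n 1)"
  shows "pair_bracket laurent_deriv (L m) (L n) = pair_scale laurent_scale (of_int (n - m)) (L (m + n))"
    and "pair_bracket laurent_deriv (I m) (I n) = 0"
    and "pair_bracket laurent_deriv (L m) (I n) = pair_scale laurent_scale (of_int n) (I (m + n))"
  by (auto simp: L_def I_def laurent_deriv_single mult_single laurent_scale_single
      pair_scale_simp[OF comm_algebra_laurent] zero_prod_def laurent_zero algebra_simps
      simp flip: single_diff)

end

theory Submission
  imports Defs
begin

text \<open>
  Write \<open>\<mu>\<close> for the componentwise product and \<open>\<phi>\<close> for the bracket on \<open>A \<oplus> A\<close>.  A form \<open>F u v\<close> has
  finite rank if it is a finite sum of products \<open>g u * h v\<close>.  The maximal good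
  subspace for \<open>\<mu>\<close> turns out to be \<open>{f. f (\<mu> u v) has finite rank}\<close>, and the theorem follows by
  comparing this space with the good subspaces for \<open>\<phi>\<close>.

  \<^item> Every good subspace, for any multiplication, consists of functionals \<open>f\<close> such that \<open>f (\<psi> u v)\<close>
    has finite rank (\<open>max_good_subspace_subset\<close>).  Conversely a subspace \<open>V\<close> of such functionals is
    good as soon as it is closed under \<open>f \<mapsto> f (\<psi> u \<cdot>)\<close> and \<open>f \<mapsto> f (\<psi> \<cdot> v)\<close>
    (\<open>good_subspaceI\<close>): a form of finite rank all of whose sections lie in \<open>V\<close> lies in \<open>V \<otimes> V\<close>
    (\<open>rank_le_in_tensor_square\<close>, by deflating the rank one step at a time).  For a commutative
    associative multiplication closure is automatic, which gives the description above.

  \<^item> If \<open>f (\<mu> u v)\<close> has finite rank, then so has \<open>f (\<phi> u v)\<close>, because \<open>\<phi> u v\<close> is a signed sum of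
    \<open>\<mu>\<close>-products of linear images of \<open>u\<close> and \<open>v\<close>; the Leibniz rule shows in the same way that
    \<open>f (\<phi> \<cdot> v)\<close> is again such a functional.  Hence the maximal good subspace for \<open>\<mu>\<close> is good for
    \<open>\<phi>\<close>, for every derivation (\<open>good_subspace_bracket\<close>).

  \<^item> For the converse put \<open>H = (h, h)\<close>.  For \<open>u = (a, c)\<close> and \<open>v = (b, d)\<close>,
    \<open>\<phi> u (\<mu> H v) - \<phi> (\<mu> H u) v = (2 \<partial>h a b, \<partial>h (a d + b c))\<close>.  If \<open>f (\<phi> u v)\<close> has finite rank,
    then so has \<open>f\<close> of the left side, as a form in \<open>u\<close> and \<open>v\<close>.  Taking \<open>u\<close> in the first summand and
    \<open>v\<close> in the first or the second one shows that \<open>f (2 \<partial>h a b, 0)\<close> and \<open>f (0, \<partial>h a d)\<close> have finite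
    rank.  Thus \<open>f (\<mu> P (\<mu> u v))\<close> has finite rank for \<open>P = (2 \<partial>h, \<partial>h)\<close>.  Because \<open>P\<close> generates
    an ideal of finite codimension, every \<open>u\<close> is \<open>\<mu> P w\<close> plus a combination of finitely many fixed
    vectors, and \<open>f (\<mu> u v)\<close> has finite rank too (\<open>finite_rank_dual_bracket_subset\<close>).

  For Laurent polynomials \<open>h = x\<close> gives \<open>P = (2, 1)\<close>, which is invertible.
\<close>

section \<open>Forms of finite rank\<close>

text \<open>
  The functions \<open>g i\<close> and \<open>h i\<close> are not required to be linear.  Over a field this makes no difference
  for bilinear forms, and it allows substituting arbitrary maps for the two arguments.
\<close>

definition rank_le :: "nat \<Rightarrow> ('x \<Rightarrow> 'y \<Rightarrow> 'k::field) \<Rightarrow> bool" where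
  "rank_le n F \<longleftrightarrow> (\<exists>g h. \<forall>u v. F u v = (\<Sum>i<n. g i u * h i v))"

definition finite_rank :: "('x \<Rightarrow> 'y \<Rightarrow> 'k::field) \<Rightarrow> bool" where
  "finite_rank F \<longleftrightarrow> (\<exists>n. rank_le n F)"

lemma finite_rankE:
  assumes "finite_rank F"
  obtains n :: nat and g h where "\<And>u v. F u v = (\<Sum>i<n. g i u * h i v)"
  using assms unfolding finite_rank_def rank_le_def by blast

lemma finite_rankI:
  fixes n :: nat
  assumes "\<And>u v. F u v = (\<Sum>i<n. g i u * h i v)"
  shows "finite_rank F"
  using assms unfolding finite_rank_def rank_le_def by blast

lemma finite_rank_0: "finite_rank (\<lambda>u v. 0)"
  by (rule finite_rankI[where n = 0]) simp

lemma finite_rank_add_product: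
  assumes "finite_rank F"
  shows "finite_rank (\<lambda>u v. F u v + p u * q v)"
proof -
  obtain n :: nat and g h where "\<And>u v. F u v = (\<Sum>i<n. g i u * h i v)"
    using assms by (rule finite_rankE) blast
  then show ?thesis
    by (intro finite_rankI[where n = "Suc n" and g = "g(n := p)" and h = "h(n := q)"]) simp
qed

lemma finite_rank_product: "finite_rank (\<lambda>u v. p u * q v)"
  using finite_rank_add_product[OF finite_rank_0] by simp

lemma finite_rank_add:
  assumes "finite_rank F" and "finite_rank G"
  shows "finite_rank (\<lambda>u v. F u v + G u v)"
proof -
  obtain n :: nat and g h where G: "\<And>u v. G u v = (\<Sum>i<n. g i u * h i v)"
    using assms(2) by (rule finite_rankE) blast
  have "finite_rank (\<lambda>u v. F u v + (\<Sum>i<m. g i u * h i v))" for m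
  proof (induction m)
    case (Suc m)
    then show ?case
      using finite_rank_add_product[OF Suc, of "g m" "h m"] by (simp add: add.assoc)
  qed (use assms(1) in simp)
  then show ?thesis by (simp add: G)
qed

lemma finite_rank_sum:
  assumes "\<And>i. i \<in> A \<Longrightarrow> finite_rank (F i)"
  shows "finite_rank (\<lambda>u v. \<Sum>i\<in>A. F i u v)"
  using assms
  by (induction A rule: infinite_finite_induct) (auto intro: finite_rank_0 finite_rank_add)

lemma finite_rank_scale:
  assumes "finite_rank F"
  shows "finite_rank (\<lambda>u v. c * F u v)"
proof -
  obtain n :: nat and g h where "\<And>u v. F u v = (\<Sum>i<n. g i u * h i v)"
    using assms by (rule finite_rankE) blast
  then show ?thesis
    by (intro finite_rankI[where n = n and g = "\<lambda>i u. c * g i u" and h = h])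
      (simp add: sum_distrib_left mult.assoc)
qed

lemma finite_rank_diff:
  assumes "finite_rank F" and "finite_rank G"
  shows "finite_rank (\<lambda>u v. F u v - G u v)"
  using finite_rank_add[OF assms(1) finite_rank_scale[OF assms(2), of "- 1"]] by simp

lemma finite_rank_compose:
  assumes "finite_rank F"
  shows "finite_rank (\<lambda>u v. F (\<alpha> u) (\<beta> v))"
proof -
  obtain n :: nat and g h where "\<And>u v. F u v = (\<Sum>i<n. g i u * h i v)"
    using assms by (rule finite_rankE) blast
  then show ?thesis
    by (intro finite_rankI[where n = n and g = "\<lambda>i u. g i (\<alpha> u)" and h = "\<lambda>i v. h i (\<beta> v)"]) simp
qed

interpretation fs: vector_space fun_scale
  by (rule vector_space_fun_scale)

lemma tensor_square_finite_rank:
  assumes "T \<in> tensor_square U"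
  shows "finite_rank (\<lambda>u v. T (u, v))"
  using assms unfolding tensor_square_def
proof (induction rule: fs.span_induct_alt)
  case base
  then show ?case by (simp add: finite_rank_0 zero_fun_def)
next
  case (step c x y)
  then obtain f g where "x = (\<lambda>(u, v). f u * g v)" by blast
  then have "finite_rank (\<lambda>u v. c * (f u * g v) + y (u, v))"
    by (intro finite_rank_add finite_rank_scale finite_rank_product step)
  with \<open>x = _\<close> show ?case by (simp add: fun_scale_def plus_fun_def)
qed

text \<open>
  The induction removes one product at a time: if \<open>F u0 v0 \<noteq> 0\<close>, then subtracting
  \<open>F u v0 * F u0 v / F u0 v0\<close> lowers the rank, and the sections of the difference remain
  combinations of sections of \<open>F\<close>.
\<close>

lemma rank_le_in_tensor_square:
  assumes "module.subspace fun_scale U"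
    and "rank_le n F"
    and "\<And>v. (\<lambda>u. F u v) \<in> U" and "\<And>u. (\<lambda>v. F u v) \<in> U"
  shows "(\<lambda>(u, v). F u v) \<in> tensor_square U"
  using assms(2-)
proof (induction n arbitrary: F)
  case 0
  then have "(\<lambda>(u, v). F u v) = 0" by (auto simp: rank_le_def fun_eq_iff)
  then show ?case unfolding tensor_square_def by (simp only: fs.span_zero)
next
  case (Suc n)
  obtain g h where F: "\<And>u v. F u v = (\<Sum>i<n. g i u * h i v) + g n u * h n v"
    using Suc.prems(1) by (auto simp: rank_le_def)
  show ?case
  proof (cases "\<exists>u0 v0. F u0 v0 \<noteq> 0 \<and> h n v0 \<noteq> 0")
    case False
    \<comment> \<open>\<open>F u v\<close> vanishes wherever \<open>h n v\<close> does not, so the last product can be dropped after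
      cutting the other \<open>h i\<close> off there.\<close>
    have "F u v = (\<Sum>i<n. g i u * (if h n v = 0 then h i v else 0))" for u v
    proof (cases "h n v = 0")
      case zero: True
      then show ?thesis by (simp add: F)
    next
      case nonzero: False
      then show ?thesis using False by auto
    qed
    then have "rank_le n F" unfolding rank_le_def
      by (intro exI[of _ g] exI[of _ "\<lambda>i v. if h n v = 0 then h i v else 0"]) blast
    then show ?thesis using Suc by blast
  next
    case True
    then obtain u0 v0 where nz: "F u0 v0 \<noteq> 0" "h n v0 \<noteq> 0" by blast
    define c where "c v = h n v / h n v0" for v
    define d where "d u = F u v0 / F u0 v0" for u
    define G where "G u v = F u v - d u * F u0 v" for u v
    have E: "(\<Sum>i<n. g i u * (h i v - c v * h i v0)) = F u v - c v * F u v0" for u v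
      using nz(2)
      by (simp add: F c_def algebra_simps sum_subtractf sum_distrib_left)
    have "G u v = (\<Sum>i<n. (g i u - d u * g i u0) * (h i v - c v * h i v0))" for u v
    proof -
      have "(\<Sum>i<n. (g i u - d u * g i u0) * (h i v - c v * h i v0)) =
          (\<Sum>i<n. g i u * (h i v - c v * h i v0))
            - d u * (\<Sum>i<n. g i u0 * (h i v - c v * h i v0))"
        by (simp add: left_diff_distrib sum_subtractf sum_distrib_left mult.assoc)
      also have "\<dots> = G u v"
        unfolding E using nz(1) by (simp add: G_def d_def algebra_simps)
      finally show ?thesis by simp
    qed
    then have "rank_le n G" unfolding rank_le_def
      by (intro exI[of _ "\<lambda>i u. g i u - d u * g i u0"] exI[of _ "\<lambda>i v. h i v - c v * h i v0"]) blast
    moreover have "(\<lambda>u. G u v) \<in> U" for v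
    proof -
      have "(\<lambda>u. F u v) - fun_scale (F u0 v / F u0 v0) (\<lambda>u. F u v0) \<in> U"
        using Suc.prems assms(1) by (intro fs.subspace_diff fs.subspace_scale) auto
      then show ?thesis by (simp add: G_def d_def fun_scale_def fun_diff_def mult.commute)
    qed
    moreover have "(\<lambda>v. G u v) \<in> U" for u
    proof -
      have "(\<lambda>v. F u v) - fun_scale (d u) (\<lambda>v. F u0 v) \<in> U"
        using Suc.prems assms(1) by (intro fs.subspace_diff fs.subspace_scale) auto
      then show ?thesis by (simp add: G_def fun_scale_def fun_diff_def)
    qed
    ultimately have G: "(\<lambda>(u, v). G u v) \<in> tensor_square U"
      by (rule Suc.IH)
    have "(\<lambda>(u, v). F u v0 * F u0 v) \<in> tensor_square U"
      unfolding tensor_square_def using Suc.prems(2)[of v0] Suc.prems(3)[of u0]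
      by (intro fs.span_base CollectI exI[of _ "\<lambda>u. F u v0"] exI[of _ "F u0"]) simp
    then have "(\<lambda>(u, v). G u v) + fun_scale (1 / F u0 v0) (\<lambda>(u, v). F u v0 * F u0 v)
        \<in> tensor_square U"
      using G unfolding tensor_square_def by (intro fs.span_add fs.span_scale)
    moreover have "(\<lambda>(u, v). G u v) + fun_scale (1 / F u0 v0) (\<lambda>(u, v). F u v0 * F u0 v)
        = (\<lambda>(u, v). F u v)"
      by (auto simp: fun_eq_iff G_def d_def fun_scale_def)
    ultimately show ?thesis by simp
  qed
qed

section \<open>Good subspaces and finite rank\<close>

text \<open>The functionals whose image under the dual map is a form of finite rank.\<close>

definition finite_rank_dual ::
  "('k::field \<Rightarrow> 'l::ab_group_add \<Rightarrow> 'l) \<Rightarrow> ('l \<Rightarrow> 'l \<Rightarrow> 'l) \<Rightarrow> ('l \<Rightarrow> 'k) set" where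
  "finite_rank_dual s \<psi> = {f \<in> dual_space s. finite_rank (\<lambda>u v. f (\<psi> u v))}"

lemma vector_space_field: "vector_space ((*) :: 'k::field \<Rightarrow> _)"
  by standard (auto simp: algebra_simps)

lemma dual_space_iff:
  assumes "vector_space s"
  shows "f \<in> dual_space s \<longleftrightarrow> (\<forall>x y. f (x + y) = f x + f y) \<and> (\<forall>c x. f (s c x) = c * f x)"
  using assms vector_space_field by (auto simp: dual_space_def Vector_Spaces.linear_iff)

lemma subspace_finite_rank_dual:
  assumes "vector_space s"
  shows "module.subspace fun_scale (finite_rank_dual s \<psi>)"
  unfolding fs.subspace_def finite_rank_dual_def
  by (auto simp: dual_space_iff[OF assms] fun_scale_def algebra_simps
      intro: finite_rank_0 finite_rank_add finite_rank_scale)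

lemma good_subspace_subset:
  assumes "good_subspace s \<psi> U"
  shows "U \<subseteq> finite_rank_dual s \<psi>"
proof
  fix f assume f: "f \<in> U"
  with assms have "dual_map \<psi> f \<in> tensor_square U" "f \<in> dual_space s"
    by (auto simp: good_subspace_def)
  with tensor_square_finite_rank[of "dual_map \<psi> f" U] show "f \<in> finite_rank_dual s \<psi>"
    by (simp add: finite_rank_dual_def dual_map_def)
qed

lemma max_good_subspace_subset:
  assumes "vector_space s"
  shows "max_good_subspace s \<psi> \<subseteq> finite_rank_dual s \<psi>"
  unfolding max_good_subspace_def
  using good_subspace_subset subspace_finite_rank_dual[OF assms] by (intro fs.span_minimal) blast

lemma good_subspace_subset_max:
  assumes "good_subspace s \<psi> U"
  shows "U \<subseteq> max_good_subspace s \<psi>"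
  unfolding max_good_subspace_def using assms by (auto intro: fs.span_base)

lemma good_subspaceI:
  assumes "module.subspace fun_scale V" and sub: "V \<subseteq> finite_rank_dual s \<psi>"
    and "\<And>f v. f \<in> V \<Longrightarrow> (\<lambda>u. f (\<psi> u v)) \<in> V"
    and "\<And>f u. f \<in> V \<Longrightarrow> (\<lambda>v. f (\<psi> u v)) \<in> V"
  shows "good_subspace s \<psi> V"
  unfolding good_subspace_def
proof (intro conjI image_subsetI)
  show "V \<subseteq> dual_space s" using sub by (auto simp: finite_rank_dual_def)
  fix f assume f: "f \<in> V"
  with sub obtain n where "rank_le n (\<lambda>u v. f (\<psi> u v))"
    by (auto simp: finite_rank_dual_def finite_rank_def)
  then have "(\<lambda>(u, v). f (\<psi> u v)) \<in> tensor_square V"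
    by (rule rank_le_in_tensor_square[OF assms(1)]) (use f assms in auto)
  then show "dual_map \<psi> f \<in> tensor_square V" by (simp add: dual_map_def)
qed fact

lemma max_good_subspace_comm_assoc:
  assumes "vector_space s"
    and comm: "\<And>u v. \<psi> u v = \<psi> v u"
    and assoc: "\<And>u v w. \<psi> (\<psi> u v) w = \<psi> u (\<psi> v w)"
    and add: "\<And>u v w. \<psi> (u + v) w = \<psi> u w + \<psi> v w"
    and scale: "\<And>c u v. \<psi> (s c u) v = s c (\<psi> u v)"
  shows "max_good_subspace s \<psi> = finite_rank_dual s \<psi>"
proof
  have sections: "(\<lambda>u. f (\<psi> u v)) \<in> finite_rank_dual s \<psi>" if "f \<in> finite_rank_dual s \<psi>" for f v
  proof -
    from that have "finite_rank (\<lambda>u w. f (\<psi> u (\<psi> w v)))"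
      by (auto simp: finite_rank_dual_def intro: finite_rank_compose[where \<alpha> = "\<lambda>u. u"])
    with that show ?thesis
      by (simp add: finite_rank_dual_def dual_space_iff[OF assms(1)] assoc add scale)
  qed
  have "good_subspace s \<psi> (finite_rank_dual s \<psi>)"
    using subspace_finite_rank_dual[OF assms(1)] sections
    by (intro good_subspaceI) (auto simp: comm)
  then show "finite_rank_dual s \<psi> \<subseteq> max_good_subspace s \<psi>"
    by (rule good_subspace_subset_max)
qed (rule max_good_subspace_subset[OF assms(1)])

section \<open>Comparison of the two multiplications\<close>

lemma pair_mult_eq: "pair_mult u v = (fst u * fst v, snd u * snd v)"
  by (cases u; cases v) simp

lemma pair_bracket_eq:
  "pair_bracket D u v =
    (fst u * D (fst v) - D (fst u) * fst v, fst u * D (snd v) - fst v * D (snd u))"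
  by (cases u; cases v) simp

context comm_algebra
begin

lemma scale_mult_right: "s c (x * y) = x * s c y"
  using scale_mult_left[of c y x] by (simp add: mult.commute)

lemma vector_space_pair: "vector_space (pair_scale s)"
proof -
  interpret vector_space_prod s s ..
  show ?thesis by (rule p.vector_space_axioms)
qed

lemma pair_scale_eq: "pair_scale s k u = (s k (fst u), s k (snd u))"
  using pair_scale_simp[OF comm_algebra_axioms] by (cases u) simp

lemma max_good_subspace_pair_mult:
  "max_good_subspace (pair_scale s) pair_mult = finite_rank_dual (pair_scale s) pair_mult"
  by (rule max_good_subspace_comm_assoc[OF vector_space_pair])
    (auto simp: pair_mult_eq pair_scale_eq scale_mult_left algebra_simps)

lemma pair_dual_add: "f \<in> dual_space (pair_scale s) \<Longrightarrow> f (u + v) = f u + f v"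
  unfolding dual_space_iff[OF vector_space_pair] by blast

lemma pair_dual_scale: "f \<in> dual_space (pair_scale s) \<Longrightarrow> f (pair_scale s k u) = k * f u"
  unfolding dual_space_iff[OF vector_space_pair] by blast

lemma pair_dual_diff: "f \<in> dual_space (pair_scale s) \<Longrightarrow> f (u - v) = f u - f v"
  using pair_dual_add[of f "u - v" v] by simp

text \<open>
  Expanding the bracket along the two summands exhibits \<open>f\<close> of it as a combination of values of the
  form \<open>f (x y, 0)\<close> and \<open>f (0, x y)\<close>.
\<close>

lemma pair_dual_bracket:
  assumes "f \<in> dual_space (pair_scale s)"
  shows "f (pair_bracket D u v) =
    f (fst u * D (fst v), 0) - f (D (fst u) * fst v, 0)
      + (f (0, fst u * D (snd v)) - f (0, D (snd u) * fst v))"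
proof -
  have "pair_bracket D u v =
      (fst u * D (fst v), 0) - (D (fst u) * fst v, 0)
        + ((0, fst u * D (snd v)) - (0, D (snd u) * fst v))"
    by (simp add: pair_bracket_eq mult.commute)
  then show ?thesis by (simp only: pair_dual_add[OF assms] pair_dual_diff[OF assms])
qed

lemma finite_rank_components:
  assumes "finite_rank (\<lambda>u v. f (pair_mult u v))"
  shows "finite_rank (\<lambda>u v. f (\<alpha> u * \<beta> v, 0))" and "finite_rank (\<lambda>u v. f (0, \<alpha> u * \<beta> v))"
  using finite_rank_compose[OF assms, of "\<lambda>u. (\<alpha> u, 0)" "\<lambda>v. (\<beta> v, 0)"]
    finite_rank_compose[OF assms, of "\<lambda>u. (0, \<alpha> u)" "\<lambda>v. (0, \<beta> v)"]
  by simp_all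

lemma good_subspace_bracket:
  assumes D: "derivation s D"
  shows "good_subspace (pair_scale s) (pair_bracket D) (finite_rank_dual (pair_scale s) pair_mult)"
proof (rule good_subspaceI)
  let ?V = "finite_rank_dual (pair_scale s) pair_mult"
  interpret D: Vector_Spaces.linear s s D using D by (simp add: derivation_def)
  have leibniz: "D (x * y) = D x * y + x * D y" for x y using D by (simp add: derivation_def)
  show V: "module.subspace fun_scale ?V"
    by (rule subspace_finite_rank_dual[OF vector_space_pair])
  show "?V \<subseteq> finite_rank_dual (pair_scale s) (pair_bracket D)"
  proof
    fix f assume "f \<in> ?V"
    then have f: "f \<in> dual_space (pair_scale s)" "finite_rank (\<lambda>u v. f (pair_mult u v))"
      by (auto simp: finite_rank_dual_def)
    have "finite_rank (\<lambda>u v. f (pair_bracket D u v))"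
      unfolding pair_dual_bracket[OF f(1)]
      by (intro finite_rank_add finite_rank_diff finite_rank_components[OF f(2)])
    with f(1) show "f \<in> finite_rank_dual (pair_scale s) (pair_bracket D)"
      by (simp add: finite_rank_dual_def)
  qed
  show left: "(\<lambda>u. f (pair_bracket D u v)) \<in> ?V" if "f \<in> ?V" for f v
  proof -
    from that have f: "f \<in> dual_space (pair_scale s)" "finite_rank (\<lambda>u v. f (pair_mult u v))"
      by (auto simp: finite_rank_dual_def)
    have "pair_bracket D (u + w) v = pair_bracket D u v + pair_bracket D w v" for u w
      by (simp add: pair_bracket_eq D.add algebra_simps)
    moreover have "pair_bracket D (pair_scale s k u) v = pair_scale s k (pair_bracket D u v)" for k u
      by (simp add: pair_bracket_eq pair_scale_eq D.scale scale_right_diff_distrib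
          flip: scale_mult_left scale_mult_right)
    ultimately have "(\<lambda>u. f (pair_bracket D u v)) \<in> dual_space (pair_scale s)"
      unfolding dual_space_iff[OF vector_space_pair]
      by (metis pair_dual_add[OF f(1)] pair_dual_scale[OF f(1)])
    moreover have "pair_bracket D (pair_mult u w) v =
        (fst u * (fst w * D (fst v)), 0)
          - ((D (fst u) * (fst w * fst v), 0) + (fst u * (D (fst w) * fst v), 0))
          + ((0, fst u * (fst w * D (snd v)))
          - ((0, D (snd u) * (snd w * fst v)) + (0, snd u * (D (snd w) * fst v))))" for u w
      by (simp add: pair_bracket_eq pair_mult_eq leibniz algebra_simps)
    then have "f (pair_bracket D (pair_mult u w) v) =
        f (fst u * (fst w * D (fst v)), 0)
          - (f (D (fst u) * (fst w * fst v), 0) + f (fst u * (D (fst w) * fst v), 0))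
          + (f (0, fst u * (fst w * D (snd v)))
          - (f (0, D (snd u) * (snd w * fst v)) + f (0, snd u * (D (snd w) * fst v))))" for u w
      by (simp only: pair_dual_add[OF f(1)] pair_dual_diff[OF f(1)])
    then have "finite_rank (\<lambda>u w. f (pair_bracket D (pair_mult u w) v))"
      by (simp only:) (intro finite_rank_add finite_rank_diff finite_rank_components[OF f(2)])
    ultimately show ?thesis by (simp add: finite_rank_dual_def)
  qed
  show "(\<lambda>v. f (pair_bracket D u v)) \<in> ?V" if f: "f \<in> ?V" for f u
  proof -
    have "pair_bracket D u v = - pair_bracket D v u" for v
      by (simp add: pair_bracket_eq mult.commute)
    moreover have "f (- w) = - f w" for w
      using f pair_dual_diff[of f 0 w] pair_dual_diff[of f 0 0] by (simp add: finite_rank_dual_def)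
    ultimately have "(\<lambda>v. f (pair_bracket D u v)) = - (\<lambda>v. f (pair_bracket D v u))"
      by (simp add: fun_eq_iff)
    then show ?thesis using fs.subspace_neg[OF V left[OF f]] by simp
  qed
qed

text \<open>
  Without a unit in \<open>A\<close> the generator need not be a multiple of itself, hence the summand
  \<open>pair_scale s k p\<close>.
\<close>

lemma ideal_generated_by_subset:
  "ideal_generated_by (pair_scale s) pair_mult p
    \<subseteq> {pair_scale s k p + pair_mult p w | k w. True}" (is "_ \<subseteq> ?J")
proof -
  interpret P: vector_space "pair_scale s" by (rule vector_space_pair)
  have mult_add: "pair_mult x (y + z) = pair_mult x y + pair_mult x z" for x y z :: "'a \<times> 'a"
    by (simp add: pair_mult_eq distrib_left)
  have mult_scale: "pair_mult x (pair_scale s k y) = pair_scale s k (pair_mult x y)" for k x y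
    by (simp add: pair_mult_eq pair_scale_eq scale_mult_right)
  have J: "P.subspace ?J"
  proof (rule P.subspaceI)
    have "pair_scale s 0 p + pair_mult p 0 \<in> ?J" by blast
    then show "0 \<in> ?J" by (simp add: pair_mult_eq zero_prod_def)
  next
    fix x y assume "x \<in> ?J" "y \<in> ?J"
    then obtain k w l z where "x = pair_scale s k p + pair_mult p w"
      "y = pair_scale s l p + pair_mult p z" by blast
    then have "x + y = pair_scale s (k + l) p + pair_mult p (w + z)"
      by (simp add: mult_add P.scale_left_distrib algebra_simps)
    then show "x + y \<in> ?J" by blast
  next
    fix c x assume "x \<in> ?J"
    then obtain k w where "x = pair_scale s k p + pair_mult p w" by blast
    then have "pair_scale s c x = pair_scale s (c * k) p + pair_mult p (pair_scale s c w)"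
      by (simp add: P.scale_right_distrib mult_scale)
    then show "pair_scale s c x \<in> ?J" by blast
  qed
  have "pair_mult x y \<in> ?J \<and> pair_mult y x \<in> ?J" if "x \<in> ?J" for x y
  proof -
    from that obtain k w where x: "x = pair_scale s k p + pair_mult p w" by blast
    have "pair_mult x y = pair_scale s 0 p + pair_mult p (pair_scale s k y + pair_mult w y)"
      by (simp add: x pair_mult_eq pair_scale_eq zero_prod_def algebra_simps
          scale_mult_left[symmetric] scale_mult_right[symmetric])
    moreover have "pair_mult y x = pair_mult x y" by (simp add: pair_mult_eq mult.commute)
    ultimately show ?thesis by (metis (mono_tags, lifting) mem_Collect_eq)
  qed
  moreover have "p \<in> ?J"
  proof -
    have "pair_scale s 1 p + pair_mult p 0 \<in> ?J" by blast
    then show ?thesis by (simp add: pair_mult_eq zero_prod_def[symmetric])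
  qed
  ultimately show ?thesis
    using J unfolding ideal_generated_by_def algebra_ideal_def by blast
qed

text \<open>
  Writing \<open>u\<close> as a combination of finitely many fixed vectors plus a multiple \<open>p w\<close> splits the form
  \<open>f (u v)\<close> into finitely many products and \<open>f (p (w v))\<close>.
\<close>

lemma finite_rank_of_finite_codim:
  assumes codim: "finite_codim (pair_scale s) (ideal_generated_by (pair_scale s) pair_mult p)"
    and f: "f \<in> dual_space (pair_scale s)"
    and R: "finite_rank (\<lambda>u v. f (pair_mult p (pair_mult u v)))"
  shows "finite_rank (\<lambda>u v. f (pair_mult u v))"
proof -
  interpret P: vector_space "pair_scale s" by (rule vector_space_pair)
  obtain B where B: "finite B"
    and dec: "\<And>v. \<exists>w \<in> P.span B. v - w \<in> ideal_generated_by (pair_scale s) pair_mult p"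
    using codim by (auto simp: finite_codim_def)
  have "\<exists>\<kappa> k w. u = (\<Sum>b\<in>B. pair_scale s (\<kappa> b) b) + pair_scale s k p + pair_mult p w"
    for u
  proof -
    obtain x where x: "x \<in> P.span B" "u - x \<in> ideal_generated_by (pair_scale s) pair_mult p"
      using dec by blast
    from x(1) obtain \<kappa> where "x = (\<Sum>b\<in>B. pair_scale s (\<kappa> b) b)"
      using P.span_finite[OF B] by auto
    moreover obtain k w where "u - x = pair_scale s k p + pair_mult p w"
      using x(2) ideal_generated_by_subset by blast
    ultimately have "u = (\<Sum>b\<in>B. pair_scale s (\<kappa> b) b) + pair_scale s k p + pair_mult p w"
      by (simp add: algebra_simps)
    then show ?thesis by blast
  qed
  then have "\<forall>u. \<exists>\<kappa> k w.
      u = (\<Sum>b\<in>B. pair_scale s (\<kappa> b) b) + pair_scale s k p + pair_mult p w"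
    by (rule allI)
  \<comment> \<open>The choices need not be linear in \<open>u\<close>: finite rank allows arbitrary functions.\<close>
  then have "\<exists>\<kappa> k w. \<forall>u.
      u = (\<Sum>b\<in>B. pair_scale s (\<kappa> u b) b) + pair_scale s (k u) p + pair_mult p (w u)"
    by (simp only: choice_iff)
  then obtain \<kappa> k w where
    u: "\<And>u. u = (\<Sum>b\<in>B. pair_scale s (\<kappa> u b) b) + pair_scale s (k u) p + pair_mult p (w u)"
    by (elim exE) (rule that, erule spec)
  have mult_add: "pair_mult (x + y) z = pair_mult x z + pair_mult y z" for x y z :: "'a \<times> 'a"
    by (simp add: pair_mult_eq distrib_right)
  have mult_scale: "pair_mult (pair_scale s c x) z = pair_scale s c (pair_mult x z)" for c x z
    by (simp add: pair_mult_eq pair_scale_eq scale_mult_left)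
  have mult_assoc: "pair_mult (pair_mult x y) z = pair_mult x (pair_mult y z)" for x y z :: "'a \<times> 'a"
    by (simp add: pair_mult_eq mult.assoc)
  have mult_sum: "f (pair_mult (\<Sum>b\<in>B. pair_scale s (c b) b) v) = (\<Sum>b\<in>B. c b * f (pair_mult b v))"
    for c v
    using B
  proof (induction B)
    case empty
    then show ?case using pair_dual_diff[OF f, of 0 0] by (simp add: pair_mult_eq zero_prod_def)
  qed (simp add: mult_add mult_scale pair_dual_add[OF f] pair_dual_scale[OF f])
  have expand: "(\<lambda>u v. f (pair_mult u v)) = (\<lambda>u v. (\<Sum>b\<in>B. \<kappa> u b * f (pair_mult b v))
      + k u * f (pair_mult p v) + f (pair_mult p (pair_mult (w u) v)))" (is "_ = ?F")
  proof (intro ext)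
    show "f (pair_mult u v) = ?F u v" for u v
      using arg_cong[OF u[of u], of "\<lambda>x. f (pair_mult x v)"]
      by (simp only: mult_add mult_scale mult_assoc mult_sum pair_dual_add[OF f] pair_dual_scale[OF f])
  qed
  show ?thesis
    by (subst expand) (intro finite_rank_add finite_rank_sum finite_rank_product
        finite_rank_compose[OF R, where \<beta> = "\<lambda>v. v"])
qed

lemma finite_rank_dual_bracket_subset:
  assumes D: "derivation s D"
    and codim: "finite_codim (pair_scale s)
      (ideal_generated_by (pair_scale s) pair_mult (s 2 (D h), D h))"
  shows "finite_rank_dual (pair_scale s) (pair_bracket D) \<subseteq> finite_rank_dual (pair_scale s) pair_mult"
proof
  fix f assume "f \<in> finite_rank_dual (pair_scale s) (pair_bracket D)"
  then have f: "f \<in> dual_space (pair_scale s)" and rank: "finite_rank (\<lambda>u v. f (pair_bracket D u v))"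
    by (auto simp: finite_rank_dual_def)
  have leibniz: "D (x * y) = D x * y + x * D y" for x y using D by (simp add: derivation_def)
  have s2: "s 2 x = x + x" for x
    using scale_left_distrib[of 1 1 x] by simp
  have "pair_bracket D u (pair_mult (h, h) v) - pair_bracket D (pair_mult (h, h) u) v =
      (s 2 (D h * (fst u * fst v)), D h * (fst u * snd v + fst v * snd u))" for u v
    by (simp add: pair_bracket_eq pair_mult_eq leibniz s2 algebra_simps)
  moreover have "finite_rank (\<lambda>u v. f (pair_bracket D u (pair_mult (h, h) v))
      - f (pair_bracket D (pair_mult (h, h) u) v))"
    by (intro finite_rank_diff finite_rank_compose[OF rank, where \<alpha> = "\<lambda>u. u"]
        finite_rank_compose[OF rank, where \<beta> = "\<lambda>v. v"])
  ultimately have Q: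
    "finite_rank (\<lambda>u v. f (s 2 (D h * (fst u * fst v)), D h * (fst u * snd v + fst v * snd u)))"
    by (simp flip: pair_dual_diff[OF f])
  have "finite_rank (\<lambda>u v. f (s 2 (D h * (fst u * fst v)), 0))"
    using finite_rank_compose[OF Q, of "\<lambda>u. (fst u, 0)" "\<lambda>v. (fst v, 0)"] by simp
  moreover have "finite_rank (\<lambda>u v. f (0, D h * (snd u * snd v)))"
    using finite_rank_compose[OF Q, of "\<lambda>u. (snd u, 0)" "\<lambda>v. (0, snd v)"] by simp
  ultimately have "finite_rank (\<lambda>u v.
      f (s 2 (D h * (fst u * fst v)), 0) + f (0, D h * (snd u * snd v)))"
    by (rule finite_rank_add)
  then have "finite_rank (\<lambda>u v. f (pair_mult (s 2 (D h), D h) (pair_mult u v)))"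
    by (simp add: pair_mult_eq scale_mult_left flip: pair_dual_add[OF f])
  then have "finite_rank (\<lambda>u v. f (pair_mult u v))"
    by (rule finite_rank_of_finite_codim[OF codim f])
  with f show "f \<in> finite_rank_dual (pair_scale s) pair_mult"
    by (simp add: finite_rank_dual_def)
qed

theorem max_good_subspace_eq:
  assumes "derivation s D"
    and "finite_codim (pair_scale s)
      (ideal_generated_by (pair_scale s) pair_mult (s 2 (D h), D h))"
  shows "max_good_subspace (pair_scale s) pair_mult = max_good_subspace (pair_scale s) (pair_bracket D)"
  unfolding max_good_subspace_pair_mult
proof
  show "finite_rank_dual (pair_scale s) pair_mult \<subseteq> max_good_subspace (pair_scale s) (pair_bracket D)"
    by (rule good_subspace_subset_max[OF good_subspace_bracket[OF assms(1)]])
  show "max_good_subspace (pair_scale s) (pair_bracket D) \<subseteq> finite_rank_dual (pair_scale s) pair_mult"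
    using max_good_subspace_subset[OF vector_space_pair] finite_rank_dual_bracket_subset[OF assms]
    by (rule subset_trans)
qed

end

section \<open>Laurent polynomials\<close>

lemma ideal_generated_by_laurent:
  fixes p :: "'f::field_char_0 laurent_poly \<times> 'f laurent_poly"
  defines "p \<equiv> (laurent_scale 2 (laurent_deriv (Poly_Mapping.single 1 1)),
    laurent_deriv (Poly_Mapping.single 1 1))"
  shows "ideal_generated_by (pair_scale laurent_scale) pair_mult p = UNIV"
proof -
  have one: "laurent_deriv (Poly_Mapping.single 1 1) = (1 :: 'f laurent_poly)"
    by (simp add: laurent_deriv_single)
  have half: "laurent_scale 2 1 * laurent_scale (1 / 2) x = x" for x :: "'f laurent_poly"
  proof -
    have inverse: "Poly_Mapping.single (0 :: int) 2 * Poly_Mapping.single 0 (1 / 2) = (1 :: 'f laurent_poly)"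
      by (simp only: mult_single) simp
    have "laurent_scale 2 1 * laurent_scale (1 / 2) x =
        Poly_Mapping.single 0 2 * Poly_Mapping.single 0 (1 / 2) * x"
      by (simp add: laurent_scale_eq_mult mult.assoc)
    also have "\<dots> = x" by (simp only: inverse mult_1_left)
    finally show ?thesis .
  qed
  have "v = pair_mult p (laurent_scale (1 / 2) (fst v), snd v)" for v
    by (simp add: p_def one half)
  then have "v \<in> I" if "algebra_ideal (pair_scale laurent_scale) pair_mult I" "p \<in> I" for v I
    using that unfolding algebra_ideal_def by metis
  then show ?thesis by (auto simp: ideal_generated_by_def)
qed

theorem theorem2p5:
  fixes s :: "'k::field \<Rightarrow> 'a::comm_ring \<Rightarrow> 'a"
    and D :: "'a \<Rightarrow> 'a"
  shows
    "(CHAR('k) \<noteq> 2 \<longrightarrow> comm_algebra s \<longrightarrow> derivation s D \<longrightarrow>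
       (\<exists>h. finite_codim (pair_scale s)
              (ideal_generated_by (pair_scale s) pair_mult (s 2 (D h), D h))) \<longrightarrow>
       max_good_subspace (pair_scale s) pair_mult =
         max_good_subspace (pair_scale s) (pair_bracket D))
     \<and>
     max_good_subspace
         (pair_scale (laurent_scale :: 'f::{alg_closed_field, field_char_0} \<Rightarrow> _)) pair_mult =
       max_good_subspace
         (pair_scale (laurent_scale :: 'f \<Rightarrow> _)) (pair_bracket laurent_deriv)"
proof (intro conjI impI)
  assume "CHAR('k) \<noteq> 2" "comm_algebra s" "derivation s D"
    "\<exists>h. finite_codim (pair_scale s)
      (ideal_generated_by (pair_scale s) pair_mult (s 2 (D h), D h))"
  then show "max_good_subspace (pair_scale s) pair_mult =
      max_good_subspace (pair_scale s) (pair_bracket D)"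
    using comm_algebra.max_good_subspace_eq by blast
next
  interpret comm_algebra "laurent_scale :: 'f \<Rightarrow> _" by (rule comm_algebra_laurent)
  interpret P: vector_space "pair_scale (laurent_scale :: 'f \<Rightarrow> _)" by (rule vector_space_pair)
  have "finite_codim (pair_scale (laurent_scale :: 'f \<Rightarrow> _)) UNIV"
    unfolding finite_codim_def by (intro exI[of _ "{}"]) auto
  then show "max_good_subspace (pair_scale (laurent_scale :: 'f \<Rightarrow> _)) pair_mult =
      max_good_subspace (pair_scale (laurent_scale :: 'f \<Rightarrow> _)) (pair_bracket laurent_deriv)"
    using max_good_subspace_eq[OF derivation_laurent, of "Poly_Mapping.single 1 1"]
    by (simp add: ideal_generated_by_laurent)
qed

end
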